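(* Every graded Gorenstein algebra (of finite vector space dimension greater than $1$ over a field $\mathbb{F}$ of characteristic zero) has Property (P).
   Context: Let $\mathbb{F}$ be a field of characteristic zero. A Gorenstein algebra of finite vector space dimension greater than $1$ over $\mathbb{F}$ is a local commutative associative unital $\mathbb{F}$-algebra $A$ with $1<\dim_{\mathbb{F}}A<\infty$ whose maximal ideal $\mathfrak{m}$ has 1-dimensional annihilator $\mathrm{Ann}(\mathfrak{m}):=\{u\in\mathfrak{m}: u\cdot\mathfrak{m}=0\}$ (dimension over $\mathbb{F}$). Such an algebra is graded if $A=\bigoplus_{j\ge 0}A_j$ with $A_jA_k\subset A_{j+k}$ for all $j,k$, where the $A_j$ are linear subspaces of $A$ and $A_0\simeq\mathbb{F}$. Then $\mathfrak{m}=\bigoplus_{j>0}A_j$, and $\mathrm{Ann}(\mathfrak{m})=A_d$ for $d:=\max\{j:A_j\neq 0\}$. $\mathbb{T}$ denotes the set of all hyperplanes (linear subspaces of codimension 1) in $\mathfrak{m}$ complementary to $\mathrm{Ann}(\mathfrak{m})$. The group $\mathrm{Aut}(\mathfrak{m})$ of $\mathbb{F}$-algebra automorphisms (not necessarily preserving the grading) of the (non-unital) algebra $\mathfrak{m}$ acts on $\mathbb{T}$ by $\Pi\mapsto\varphi(\Pi)$. The algebra $A$ has Property (P) if this action of $\mathrm{Aut}(\mathfrak{m})$ on $\mathbb{T}$ is transitive. *)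

theory Defs
  imports Complex_Main
begin

definition maximal_ideal :: "'a::comm_ring_1 set \<Rightarrow> bool" where
  "maximal_ideal M \<longleftrightarrow>
     module.subspace (*) M \<and> M \<noteq> UNIV \<and>
     (\<forall>I. module.subspace (*) I \<longrightarrow> M \<subseteq> I \<longrightarrow> I = M \<or> I = UNIV)"
  (* The submodules of a commutative ring, as a module over itself, are its ideals. *)

text \<open>The maximal ideal \<open>\<mm>\<close>; meaningful only when the ring is local.\<close>

definition max_ideal :: "'a::comm_ring_1 set" ("\<mm>") where
  "\<mm> = (THE M. maximal_ideal M)"

definition Ann :: "'a::comm_ring_1 set \<Rightarrow> 'a set" where
  "Ann M = {u \<in> M. \<forall>v\<in>M. u * v = 0}"

text \<open>The algebra \<open>A\<close> is the whole type \<open>'a\<close>; the scalars are the field \<open>'f\<close>.\<close>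

locale comm_algebra = vector_space scale
  for scale :: "'f::field_char_0 \<Rightarrow> 'a::comm_ring_1 \<Rightarrow> 'a" (infixr "*s" 75) +
  assumes scale_mult_left: "(c *s x) * y = c *s (x * y)"
begin

definition is_grading :: "(nat \<Rightarrow> 'a set) \<Rightarrow> bool" where
  "is_grading \<A> \<longleftrightarrow>
     (\<forall>j. subspace (\<A> j)) \<and>
     (\<forall>a. \<exists>!c. (\<forall>j. c j \<in> \<A> j) \<and> finite {j. c j \<noteq> 0} \<and> a = (\<Sum>j | c j \<noteq> 0. c j)) \<and>
     (\<forall>j k. \<forall>x\<in>\<A> j. \<forall>y\<in>\<A> k. x * y \<in> \<A> (j + k)) \<and>
     (\<exists>f. Vector_Spaces.linear (*) (*s) f \<and> (\<forall>a b. f (a * b) = f a * f b) \<and> inj f \<and> range f = \<A> 0)"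
  (* The second conjunct is the internal direct sum; the last one is the isomorphism of the
     ground field with the degree-zero part, as algebras. *)

definition graded :: bool where
  "graded \<longleftrightarrow> (\<exists>\<A>. is_grading \<A>)"

text \<open>The set \<open>\<T>\<close>; codimension is taken in \<open>\<mm>\<close>.\<close>

definition compl_hyperplanes :: "'a set set" ("\<T>") where
  "\<T> = {\<Pi>. subspace \<Pi> \<and> \<Pi> \<subseteq> \<mm> \<and> dim \<Pi> + 1 = dim (\<mm> :: 'a set) \<and>
          \<Pi> \<inter> Ann \<mm> = {0} \<and> {p + u | p u. p \<in> \<Pi> \<and> u \<in> Ann \<mm>} = \<mm>}"

text \<open>Automorphisms of the non-unital algebra \<open>\<mm>\<close> are represented by functions on all of
  \<open>'a\<close>, of which only the values on \<open>\<mm>\<close> matter.\<close>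

definition Aut_max_ideal :: "('a \<Rightarrow> 'a) set" where
  "Aut_max_ideal = {\<phi>. bij_betw \<phi> \<mm> \<mm> \<and>
     (\<forall>x\<in>\<mm>. \<forall>y\<in>\<mm>. \<phi> (x + y) = \<phi> x + \<phi> y) \<and>
     (\<forall>c. \<forall>x\<in>\<mm>. \<phi> (c *s x) = c *s \<phi> x) \<and>
     (\<forall>x\<in>\<mm>. \<forall>y\<in>\<mm>. \<phi> (x * y) = \<phi> x * \<phi> y)}"

definition property_P :: bool where
  "property_P \<longleftrightarrow> (\<forall>\<Pi>\<^sub>1\<in>\<T>. \<forall>\<Pi>\<^sub>2\<in>\<T>. \<exists>\<phi>\<in>Aut_max_ideal. \<phi> ` \<Pi>\<^sub>1 = \<Pi>\<^sub>2)"

end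

locale gorenstein_algebra = comm_algebra scale
  for scale :: "'f::field_char_0 \<Rightarrow> 'a::comm_ring_1 \<Rightarrow> 'a" (infixr "*s" 75) +
  assumes local: "\<exists>!M :: 'a set. maximal_ideal M"
    and finite_dimensional: "\<exists>B. finite B \<and> span B = UNIV"
    and dim_gt_1: "dim (UNIV :: 'a set) > 1"
    and dim_Ann: "dim (Ann (\<mm> :: 'a set)) = 1"

end

theory Submission
  imports Defs
begin

text \<open>For \<open>g\<close> with degree-zero component \<open>1\<close>, sending \<open>x\<close> in \<open>A\<^sub>j\<close> to \<open>g^j x\<close>
  defines an automorphism. A hyperplane complementary to \<open>Ann \<mm> = A\<^sub>d\<close> is the kernel of a
  functional with value \<open>1\<close> on the socle generator; as the form \<open>(x, y) \<mapsto> (x y)\<^sub>d\<close> is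
  nondegenerate, this functional is \<open>x \<mapsto> (u x)\<^sub>d\<close> for some \<open>u\<close> with \<open>u\<^sub>0 = 1\<close>. The automorphism
  given by \<open>g\<close> carries the hyperplane of \<open>u\<close> to that of \<open>w\<close> as soon as \<open>w g^(d - k)\<close> and \<open>u\<close> have
  the same component of degree \<open>k\<close> for all \<open>k < d\<close>. In these equations the component \<open>g\<^sub>k\<close> appears
  with the coefficient \<open>d - k\<close>, nonzero in characteristic zero, so they can be solved one degree
  at a time.\<close>

section \<open>Scalars, and the coordinate along a vector modulo a hyperplane\<close>

context comm_algebra
begin

lemma scale_mult_right: "x * (c *s y) = c *s (x * y)"
  using scale_mult_left[of c y x] by (simp add: mult.commute)

lemma of_nat_mult_eq_scale: "of_nat n * x = of_nat n *s x"
  by (induction n) (simp_all add: algebra_simps scale_left_distrib)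

text \<open>Two different coefficients for the same \<open>a\<close> would put a nonzero multiple of
  \<open>s\<close> into \<open>W\<close>. So the coordinate along \<open>s\<close> modulo
  \<open>W\<close> is well defined, and uniqueness makes it linear.\<close>

lemma coordinate_functional:
  assumes "subspace W" "\<And>a. \<exists>c. a - c *s s \<in> W" "s \<notin> W"
  obtains f where "Vector_Spaces.linear scale (*) f" "f s = 1" "\<And>a. a - f a *s s \<in> W"
    "\<And>a. f a = 0 \<longleftrightarrow> a \<in> W"
proof -
  have uniq: "c = c'" if "a - c *s s \<in> W" "a - c' *s s \<in> W" for a c c'
  proof (rule ccontr)
    assume "c \<noteq> c'"
    have "(a - c' *s s) - (a - c *s s) \<in> W"
      using that assms(1) by (simp only: subspace_diff)
    then have "(c - c') *s s \<in> W" by (simp add: scale_left_diff_distrib)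
    then have "(1 / (c - c')) *s ((c - c') *s s) \<in> W"
      using assms(1) by (simp only: subspace_scale)
    with \<open>c \<noteq> c'\<close> assms(3) show False by simp
  qed
  obtain f where f: "a - f a *s s \<in> W" for a using assms(2) by metis
  have "f (a + b) = f a + f b" for a b
    using subspace_add[OF assms(1) f[of a] f[of b]]
    by (intro uniq[OF f]) (simp add: algebra_simps)
  moreover have "f (c *s a) = c * f a" for a c
    using subspace_scale[OF assms(1) f[of a], of c]
    by (intro uniq[OF f]) (simp add: algebra_simps)
  ultimately have "Vector_Spaces.linear scale (*) f"
    by unfold_locales (auto simp: algebra_simps)
  moreover have "f s = 1" using subspace_0[OF assms(1)] by (intro uniq[OF f]) simp
  moreover have "f a = 0 \<longleftrightarrow> a \<in> W" for a
    using f[of a] uniq[OF f, of a 0] by auto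
  ultimately show ?thesis using f that by blast
qed

end

section \<open>Homogeneous components\<close>

locale graded_gorenstein_algebra = gorenstein_algebra scale
  for scale :: "'f::field_char_0 \<Rightarrow> 'a::comm_ring_1 \<Rightarrow> 'a" (infixr "*s" 75) +
  fixes \<A> :: "nat \<Rightarrow> 'a set"
  assumes grading: "is_grading \<A>"
begin

text \<open>Uniqueness is available only for whole families of components, so \<open>THE\<close>
  selects a family, which is then evaluated at \<open>j\<close>.\<close>

definition comp :: "nat \<Rightarrow> 'a \<Rightarrow> 'a" where
  "comp j a =
    (THE c. (\<forall>j. c j \<in> \<A> j) \<and> finite {j. c j \<noteq> 0} \<and> a = (\<Sum>j | c j \<noteq> 0. c j)) j"

lemma subspace_homogeneous: "subspace (\<A> j)"
  and mult_homogeneous: "x \<in> \<A> j \<Longrightarrow> y \<in> \<A> k \<Longrightarrow> x * y \<in> \<A> (j + k)"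
  and unique_decomposition:
    "\<exists>!c. (\<forall>j. c j \<in> \<A> j) \<and> finite {j. c j \<noteq> 0} \<and> a = (\<Sum>j | c j \<noteq> 0. c j)"
  using grading unfolding is_grading_def by auto

lemma comp_homogeneous: "comp j a \<in> \<A> j"
  and finite_comp: "finite {j. comp j a \<noteq> 0}"
  and sum_comp_support: "(\<Sum>j | comp j a \<noteq> 0. comp j a) = a"
proof -
  have *: "(\<lambda>j. comp j a) =
    (THE c. (\<forall>j. c j \<in> \<A> j) \<and> finite {j. c j \<noteq> 0} \<and> a = (\<Sum>j | c j \<noteq> 0. c j))"
    unfolding comp_def by simp
  from theI'[OF unique_decomposition[of a]]
  show "comp j a \<in> \<A> j" "finite {j. comp j a \<noteq> 0}" "(\<Sum>j | comp j a \<noteq> 0. comp j a) = a"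
    unfolding *[symmetric] by simp_all
qed

text \<open>\<open>J\<close> may exceed the support, so that the components of a sum can be read off
  over the union of two supports.\<close>

lemma comp_eqI:
  assumes "\<And>j. c j \<in> \<A> j" "finite J" "\<And>j. j \<notin> J \<Longrightarrow> c j = 0" "a = (\<Sum>j\<in>J. c j)"
  shows "comp j a = c j"
proof -
  have sub: "{j. c j \<noteq> 0} \<subseteq> J" using assms(3) by auto
  let ?decomposes = "\<lambda>c. (\<forall>j. c j \<in> \<A> j) \<and> finite {j. c j \<noteq> 0} \<and> a = (\<Sum>j | c j \<noteq> 0. c j)"
  have "?decomposes c"
    using assms sub by (auto intro: finite_subset sum.mono_neutral_right)
  then have "(THE c. ?decomposes c) = c" by (rule the1_equality[OF unique_decomposition])
  then show ?thesis unfolding comp_def by (rule fun_cong)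
qed

lemma sum_comp:
  assumes "finite J" "\<And>j. j \<notin> J \<Longrightarrow> comp j a = 0"
  shows "(\<Sum>j\<in>J. comp j a) = a"
proof -
  have "(\<Sum>j\<in>J. comp j a) = (\<Sum>j | comp j a \<noteq> 0. comp j a)"
    using assms by (intro sum.mono_neutral_right) auto
  then show ?thesis by (simp add: sum_comp_support)
qed

lemma comp_of_homogeneous: "x \<in> \<A> k \<Longrightarrow> comp j x = (if j = k then x else 0)"
  by (rule comp_eqI[where J = "{k}"]) (auto simp: subspace_0 subspace_homogeneous)

lemma comp_add [simp]: "comp j (a + b) = comp j a + comp j b"
proof (rule comp_eqI[where J = "{j. comp j a \<noteq> 0} \<union> {j. comp j b \<noteq> 0}"])
  show "a + b = (\<Sum>j\<in>{j. comp j a \<noteq> 0} \<union> {j. comp j b \<noteq> 0}. comp j a + comp j b)"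
    unfolding sum.distrib
    by (intro arg_cong2[where f = "(+)"] sum_comp[symmetric]) (auto simp: finite_comp)
qed (auto simp: finite_comp comp_homogeneous subspace_add subspace_homogeneous)

lemma comp_scale [simp]: "comp j (r *s a) = r *s comp j a"
proof (rule comp_eqI[where J = "{j. comp j a \<noteq> 0}"])
  show "r *s a = (\<Sum>j | comp j a \<noteq> 0. r *s comp j a)"
    unfolding scale_sum_right[symmetric] by (simp add: sum_comp_support)
qed (auto simp: finite_comp comp_homogeneous subspace_scale subspace_homogeneous)

lemma linear_comp: "Vector_Spaces.linear scale scale (comp j)"
  by unfold_locales simp_all

lemma comp_0 [simp]: "comp j 0 = 0"
  using comp_scale[of j 0 0] by simp

lemma comp_diff [simp]: "comp j (a - b) = comp j a - comp j b"
  using comp_add[of j "a - b" b] by (simp add: algebra_simps)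

lemma comp_sum [simp]: "comp j (sum f S) = (\<Sum>i\<in>S. comp j (f i))"
  by (induction S rule: infinite_finite_induct) simp_all

lemma comp_comp [simp]: "comp i (comp j a) = (if i = j then comp j a else 0)"
  by (rule comp_of_homogeneous[OF comp_homogeneous])

text \<open>Only the component of \<open>a\<close> of degree \<open>j - k\<close> reaches degree
  \<open>j\<close>; the condition \<open>k \<le> j\<close> guards against truncated
  subtraction.\<close>

lemma comp_mult_homogeneous:
  assumes "v \<in> \<A> k"
  shows "comp j (a * v) = (if k \<le> j then comp (j - k) a * v else 0)"
proof -
  have h: "comp j (comp i a * v) = (if j = i + k then comp i a * v else 0)" for i
    using assms by (intro comp_of_homogeneous mult_homogeneous comp_homogeneous)
  have "comp j (a * v) = comp j ((\<Sum>i | comp i a \<noteq> 0. comp i a) * v)"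
    by (simp add: sum_comp_support)
  also have "\<dots> = (\<Sum>i | comp i a \<noteq> 0. if j = i + k then comp i a * v else 0)"
    by (simp add: sum_distrib_right h)
  also have "\<dots> = (\<Sum>i | comp i a \<noteq> 0. if i = j - k then (if k \<le> j then comp i a * v else 0) else 0)"
    by (intro sum.cong) auto
  also have "\<dots> = (if k \<le> j then comp (j - k) a * v else 0)"
    using finite_comp by (auto simp: sum.delta)
  finally show ?thesis .
qed

text \<open>Comparing components of degree \<open>j\<close> in \<open>1 * comp j a\<close> shows
  that \<open>comp 0 1\<close> fixes every homogeneous component, hence also their sum
  \<open>1\<close>.\<close>

lemma comp_zero_one [simp]: "comp 0 1 = 1"
proof -
  have "comp 0 1 * comp j a = comp j a" for j a
    using comp_mult_homogeneous[OF comp_homogeneous, of j 1 j a] by simp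
  then have "comp 0 1 * (\<Sum>j | comp j 1 \<noteq> 0. comp j 1) = (\<Sum>j | comp j 1 \<noteq> 0. comp j 1)"
    by (simp add: sum_distrib_left)
  then show ?thesis by (simp add: sum_comp_support)
qed

lemma one_homogeneous: "1 \<in> \<A> 0"
  using comp_homogeneous[of 0 1] by simp

text \<open>The degree-zero part is the image of the one-dimensional space of scalars and contains
  \<open>1\<close>, which is nonzero.\<close>

lemma homogeneous_zero: "x \<in> \<A> 0 \<Longrightarrow> \<exists>r. x = r *s 1"
proof -
  assume x: "x \<in> \<A> 0"
  obtain f where f: "Vector_Spaces.linear (*) (*s) f" "range f = \<A> 0"
    using grading unfolding is_grading_def by blast
  interpret f: Vector_Spaces.linear "(*)" "(*s)" f by (rule f(1))
  have *: "f r = r *s f 1" for r using f.scale[of r 1] by simp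
  obtain q where q: "1 = f q" using one_homogeneous f(2) by (metis imageE)
  obtain r where r: "x = f r" using x f(2) by (metis imageE)
  have "q \<noteq> 0" using q f.zero by auto
  then have "f 1 = (1 / q) *s (q *s f 1)" by simp
  also have "q *s f 1 = 1" using q *[of q] by simp
  finally have "x = r *s (1 / q) *s 1" using r *[of r] by simp
  then have "x = (r / q) *s 1" by simp
  then show ?thesis by blast
qed

lemma comp_zero_scalar: obtains r where "comp 0 a = r *s 1"
  using homogeneous_zero comp_homogeneous by blast

lemma comp_zero_mult [simp]: "comp 0 (a * b) = comp 0 a * comp 0 b"
proof -
  have "comp 0 (a * comp j b) = (if j = 0 then comp 0 a * comp 0 b else 0)" for j
    by (simp add: comp_mult_homogeneous[OF comp_homogeneous])
  then have *: "comp 0 (a * (\<Sum>j\<in>insert 0 {j. comp j b \<noteq> 0}. comp j b)) = comp 0 a * comp 0 b"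
    by (simp add: sum_distrib_left finite_comp sum.delta del: sum.insert_remove sum.insert)
  have "(\<Sum>j\<in>insert 0 {j. comp j b \<noteq> 0}. comp j b) = b"
    by (rule sum_comp) (auto simp: finite_comp)
  with * show ?thesis by simp
qed

lemma comp_zero_power [simp]: "comp 0 (a ^ n) = comp 0 a ^ n"
  by (induction n) simp_all

section \<open>The maximal ideal as the kernel of the degree-zero component\<close>

lemma one_neq_zero: "(1::'a) \<noteq> 0"
proof
  assume "(1::'a) = 0"
  then have "x = 0" for x :: 'a using mult_1_right[of x] by simp
  then have "(UNIV :: 'a set) = {0}" by auto
  then show False using dim_gt_1 dim_le_card[of UNIV "{}"] by simp
qed

lemma ideal_iff: "module.subspace (*) (I :: 'a set) \<longleftrightarrow>
    0 \<in> I \<and> (\<forall>x\<in>I. \<forall>y\<in>I. x + y \<in> I) \<and> (\<forall>c. \<forall>x\<in>I. c * x \<in> I)"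
proof -
  interpret R: module "(*) :: 'a \<Rightarrow> 'a \<Rightarrow> 'a" by unfold_locales (simp_all add: algebra_simps)
  show ?thesis by (rule R.subspace_def)
qed

text \<open>An ideal that contains this kernel and an element outside it also contains the
  degree-zero component of that element, a nonzero scalar and hence a unit. So the kernel is
  maximal, and locality identifies it.\<close>

lemma max_ideal_eq: "\<mm> = {a. comp 0 a = 0}"
proof -
  let ?M = "{a. comp 0 a = 0}"
  have "maximal_ideal ?M"
    unfolding maximal_ideal_def ideal_iff
  proof (intro conjI allI impI)
    show "?M \<noteq> UNIV" using one_neq_zero comp_zero_one by (metis UNIV_I mem_Collect_eq)
    fix I :: "'a set"
    assume I: "0 \<in> I \<and> (\<forall>x\<in>I. \<forall>y\<in>I. x + y \<in> I) \<and> (\<forall>c. \<forall>x\<in>I. c * x \<in> I)" and "?M \<subseteq> I"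
    show "I = ?M \<or> I = UNIV"
    proof (rule disjCI)
      assume "I \<noteq> UNIV"
      have "comp 0 a = 0" if "a \<in> I" for a
      proof (rule ccontr)
        assume "comp 0 a \<noteq> 0"
        obtain r where r: "comp 0 a = r *s 1" by (rule comp_zero_scalar)
        have "r \<noteq> 0" using r \<open>comp 0 a \<noteq> 0\<close> by auto
        have "comp 0 a - a \<in> I" using \<open>?M \<subseteq> I\<close> by auto
        then have "(comp 0 a - a) + a \<in> I" using I that by blast
        then have "((1 / r) *s x) * (r *s 1) \<in> I" for x using I r by auto
        then have "x \<in> I" for x using \<open>r \<noteq> 0\<close> by (simp add: scale_mult_right)
        then show False using \<open>I \<noteq> UNIV\<close> by auto
      qed
      then show "I = ?M" using \<open>?M \<subseteq> I\<close> by auto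
    qed
  qed simp_all
  then show ?thesis unfolding max_ideal_def using local by (simp add: the1_equality)
qed

section \<open>Finite dimension and the top degree\<close>

lemma finite_span_UNIV: obtains B where "finite B" "independent B" "span B = UNIV"
proof -
  obtain B where "finite B" "span B = UNIV" using finite_dimensional by blast
  moreover obtain C where "C \<subseteq> B" "independent C" "B \<subseteq> span C"
    using maximal_independent_subset by blast
  ultimately show ?thesis
    using that by (metis finite_subset span_minimal subspace_span top.extremum_uniqueI)
qed

lemma linear_inj_imp_surj:
  assumes "Vector_Spaces.linear scale scale f" "inj f"
  shows "surj f"
proof -
  obtain B where "finite B" "independent B" "span B = UNIV" using finite_span_UNIV by blast
  then interpret F: finite_dimensional_vector_space scale B by unfold_locales auto
  show ?thesis using F.linear_inj_imp_surj assms by blast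
qed

definition top_degree :: nat where
  "top_degree = Max {j. \<exists>x. comp j x \<noteq> 0}"

lemma top_degree_in: "\<exists>x. comp top_degree x \<noteq> 0"
  and comp_above_top: "top_degree < j \<Longrightarrow> comp j x = 0"
proof -
  obtain B where B: "finite B" "span B = UNIV" using finite_span_UNIV by blast
  \<comment> \<open>By linearity, a degree absent from a finite spanning set is absent everywhere;
    so finitely many degrees occur and \<open>Max\<close> is meaningful.\<close>
  have "comp j x = 0" if "j \<notin> (\<Union>b\<in>B. {j. comp j b \<noteq> 0})" for j x
  proof -
    interpret cj: Vector_Spaces.linear scale scale "comp j" by (rule linear_comp)
    show ?thesis using cj.eq_0_on_span[of B x] that B(2) by auto
  qed
  then have "{j. \<exists>x. comp j x \<noteq> 0} \<subseteq> (\<Union>b\<in>B. {j. comp j b \<noteq> 0})" by auto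
  then have fin: "finite {j. \<exists>x. comp j x \<noteq> 0}"
    by (rule finite_subset) (simp add: B(1) finite_comp)
  have "0 \<in> {j. \<exists>x. comp j x \<noteq> 0}"
    using comp_zero_one one_neq_zero by (auto intro: exI[of _ 1])
  then have "top_degree \<in> {j. \<exists>x. comp j x \<noteq> 0}"
    unfolding top_degree_def using fin Max_in by blast
  then show "\<exists>x. comp top_degree x \<noteq> 0" by simp
  assume "top_degree < j"
  then show "comp j x = 0"
    using Max_ge[OF fin, of j] unfolding top_degree_def[symmetric] by fastforce
qed

lemma sum_comp_top: "(\<Sum>j\<le>top_degree. comp j a) = a"
  by (rule sum_comp) (auto simp: comp_above_top)

lemma comp_eq_0_imp: "(\<And>j. j \<le> top_degree \<Longrightarrow> comp j a = 0) \<Longrightarrow> a = 0"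
  using sum_comp_top[of a] by simp

lemma homogeneous_above_top: "x \<in> \<A> j \<Longrightarrow> top_degree < j \<Longrightarrow> x = 0"
  using comp_above_top[of j x] comp_of_homogeneous[of x j j] by simp

section \<open>The annihilator of the maximal ideal\<close>

lemma subspace_Ann: "subspace (Ann \<mm>)"
  unfolding Ann_def max_ideal_eq
  by (auto simp: subspace_def distrib_right scale_mult_left)

text \<open>Any nonzero element of top degree serves: it turns out to span the annihilator of
  \<open>\<mm>\<close>.\<close>

definition socle :: 'a where "socle = (SOME s. s \<in> \<A> top_degree \<and> s \<noteq> 0)"

lemma socle: "socle \<in> \<A> top_degree" "socle \<noteq> 0"
  using someI_ex[of "\<lambda>s. s \<in> \<A> top_degree \<and> s \<noteq> 0"] top_degree_in comp_homogeneous
  unfolding socle_def by blast+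

text \<open>Components of \<open>a\<close> of positive degree push \<open>v\<close> beyond the top
  degree.\<close>

lemma comp_mult_top: "a * v = comp 0 a * v" if "v \<in> \<A> top_degree"
proof -
  have "comp j (a * v) = (if j = top_degree then comp 0 a * v else 0)"
    if "j \<le> top_degree" for j
    using that comp_mult_homogeneous[OF \<open>v \<in> _\<close>, of j a] by auto
  then have "(\<Sum>j\<le>top_degree. comp j (a * v)) = comp 0 a * v" by simp
  then show ?thesis by (simp only: sum_comp_top)
qed

text \<open>Otherwise the algebra would equal its degree-zero part, so \<open>\<mm>\<close> and its
  annihilator would vanish, against \<open>dim_Ann\<close>.\<close>

lemma top_degree_pos: "top_degree > 0"
proof (rule ccontr)
  assume "\<not> top_degree > 0"
  then have "a = comp 0 a" for a using sum_comp_top[of a] by simp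
  then have "Ann \<mm> \<subseteq> {0::'a}" unfolding Ann_def max_ideal_eq by auto
  then have "dim (Ann (\<mm> :: 'a set)) \<le> 0"
    using dim_le_card[of "Ann \<mm>" "{}"] by simp
  then show False using dim_Ann by simp
qed

lemma socle_in_max_ideal: "socle \<in> \<mm>"
  using top_degree_pos socle(1) by (simp add: max_ideal_eq comp_of_homogeneous)

lemma top_subset_Ann: "\<A> top_degree \<subseteq> Ann \<mm>"
proof
  fix x assume x: "x \<in> \<A> top_degree"
  have "x * v = 0" if "v \<in> \<mm>" for v
  proof -
    have "x * v = comp 0 v * x" using comp_mult_top[OF x, of v] by (simp only: mult.commute)
    also have "\<dots> = 0" using that by (simp add: max_ideal_eq)
    finally show ?thesis .
  qed
  then show "x \<in> Ann \<mm>"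
    using top_degree_pos x unfolding Ann_def max_ideal_eq by (simp add: comp_of_homogeneous)
qed

lemma Ann_eq: "Ann \<mm> = range (\<lambda>c. c *s socle)"
proof -
  have s: "socle \<in> Ann \<mm>" using socle(1) top_subset_Ann by blast
  obtain B where B: "B \<subseteq> Ann \<mm>" "independent B" "Ann \<mm> \<subseteq> span B" "card B = dim (Ann (\<mm> :: 'a set))"
    using basis_exists by blast
  then have "card B = 1" using dim_Ann by simp
  then obtain b where b: "B = {b}" using card_1_singletonE by blast
  then obtain r where r: "socle = r *s b" using s B(3) by (auto simp: span_singleton)
  then have "r \<noteq> 0" using socle(2) by auto
  then have "b = (1 / r) *s socle" using r by simp
  then have "Ann \<mm> \<subseteq> range (\<lambda>c. c *s socle)" using B(3) b by (auto simp: span_singleton)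
  then show ?thesis using s subspace_scale[OF subspace_Ann] by auto
qed

lemma top_scalar: "x \<in> \<A> top_degree \<Longrightarrow> \<exists>c. x = c *s socle"
  using top_subset_Ann unfolding Ann_eq by auto

section \<open>Functionals attached to the top degree and to hyperplanes\<close>

lemma top_functional:
  obtains f where "Vector_Spaces.linear scale (*) f" "\<And>a. comp top_degree a = f a *s socle"
proof -
  let ?W = "{a. comp top_degree a = 0}"
  have sub: "subspace ?W" by (simp add: subspace_def)
  have ex: "\<exists>c. a - c *s socle \<in> ?W" for a
  proof -
    obtain c where "comp top_degree a = c *s socle" using top_scalar comp_homogeneous by blast
    then show ?thesis using socle(1) by (intro exI[of _ c]) (simp add: comp_of_homogeneous)
  qed
  have notin: "socle \<notin> ?W" using socle by (simp add: comp_of_homogeneous)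
  from coordinate_functional[OF sub ex notin] obtain f where
    "Vector_Spaces.linear scale (*) f" and f: "\<And>a. a - f a *s socle \<in> ?W" by metis
  moreover have "comp top_degree a = f a *s socle" for a
    using f[of a] socle(1) by (simp add: comp_of_homogeneous)
  ultimately show ?thesis using that by blast
qed

lemma hyperplane_functional:
  assumes "\<Pi> \<in> \<T>"
  obtains f where "Vector_Spaces.linear scale (*) f" "f socle = 1" "\<Pi> = {x \<in> \<mm>. f x = 0}"
proof -
  \<comment> \<open>This is the sum of \<open>\<Pi>\<close> and the degree-zero part, a hyperplane
    of the whole algebra: the functional on \<open>\<mm>\<close> is extended by zero to degree
    zero.\<close>
  let ?W = "{a. a - comp 0 a \<in> \<Pi>}"
  have \<Pi>: "subspace \<Pi>" "\<Pi> \<subseteq> \<mm>" "\<Pi> \<inter> Ann \<mm> = {0}" "{p + u | p u. p \<in> \<Pi> \<and> u \<in> Ann \<mm>} = \<mm>"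
    using assms unfolding compl_hyperplanes_def by auto
  have cs: "comp 0 socle = 0" using socle_in_max_ideal by (simp add: max_ideal_eq)
  have sub: "subspace ?W"
  proof (rule subspaceI)
    fix x y c assume "x \<in> ?W" "y \<in> ?W"
    then show "x + y \<in> ?W"
      using subspace_add[OF \<Pi>(1), of "x - comp 0 x" "y - comp 0 y"] by (simp add: algebra_simps)
    show "c *s x \<in> ?W"
      using \<open>x \<in> ?W\<close> subspace_scale[OF \<Pi>(1), of "x - comp 0 x" c] by (simp add: algebra_simps)
  qed (simp add: subspace_0 \<Pi>(1))
  have ex: "\<exists>c. a - c *s socle \<in> ?W" for a
  proof -
    have "a - comp 0 a \<in> \<mm>" by (simp add: max_ideal_eq)
    then obtain p u where pu: "a - comp 0 a = p + u" "p \<in> \<Pi>" "u \<in> Ann \<mm>" using \<Pi>(4) by blast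
    then obtain c where "u = c *s socle" unfolding Ann_eq by auto
    then have "a - c *s socle - comp 0 (a - c *s socle) = p" using pu(1) cs by (simp add: algebra_simps)
    then show ?thesis using pu(2) by auto
  qed
  have "socle \<in> Ann \<mm>" unfolding Ann_eq by (rule range_eqI[of _ _ 1]) simp
  then have notin: "socle \<notin> ?W" using \<Pi>(3) socle(2) cs by auto
  from coordinate_functional[OF sub ex notin] obtain f where
    f: "Vector_Spaces.linear scale (*) f" "f socle = 1" "\<And>a. f a = 0 \<longleftrightarrow> a \<in> ?W" by metis
  moreover have "\<Pi> = {x \<in> \<mm>. f x = 0}" using \<Pi>(2) f(3) by (auto simp: max_ideal_eq)
  ultimately show ?thesis using that by blast
qed

section \<open>Nondegeneracy of the top-degree form and representation of functionals\<close>

lemma top_form_nondegenerate: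
  assumes "\<And>y. comp top_degree (u * y) = 0"
  shows "u = 0"
proof -
  text \<open>Descending induction on the order of \<open>u\<close>: multiplying by \<open>\<mm>\<close> raises the order, so by
    induction \<open>u\<close> annihilates \<open>\<mm>\<close>.\<close>
  have "u = 0" if "k \<le> Suc top_degree" "\<And>i. i < k \<Longrightarrow> comp i u = 0" "\<And>y. comp top_degree (u * y) = 0"
    for k u
    using that
  proof (induction k arbitrary: u rule: inc_induct)
    case base
    show ?case by (rule comp_eq_0_imp) (simp add: base less_Suc_eq_le)
  next
    case (step k)
    have ann: "u * v = 0" if "v \<in> \<mm>" for v
    proof (rule step.IH)
      fix i assume "i < Suc k"
      have "comp i (u * comp j v) = 0" for j
      proof (cases "j = 0")
        case False
        then show ?thesis using step.prems(1) \<open>i < Suc k\<close>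
          by (simp add: comp_mult_homogeneous[OF comp_homogeneous])
      qed (use that in \<open>simp add: max_ideal_eq\<close>)
      then have "comp i (u * (\<Sum>j\<le>top_degree. comp j v)) = 0" by (simp add: sum_distrib_left)
      then show "comp i (u * v) = 0" by (simp only: sum_comp_top)
    next
      show "comp top_degree (u * v * y) = 0" for y
        using step.prems(2)[of "v * y"] by (simp add: mult.assoc)
    qed
    \<comment> \<open>Multiplication by \<open>socle\<close> sees only the scalar part of
      \<open>u\<close>, so this part vanishes and \<open>u\<close> is a multiple of
      \<open>socle\<close>; testing with \<open>1\<close> shows that the multiple is zero.\<close>
    obtain r where r: "comp 0 u = r *s 1" by (rule comp_zero_scalar)
    have "r *s socle = 0"
      using ann[OF socle_in_max_ideal] comp_mult_top[OF socle(1), of u] r by (simp add: scale_mult_left)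
    then have "comp 0 u = 0" using r socle(2) by simp
    then have "u \<in> Ann \<mm>" using ann by (simp add: Ann_def max_ideal_eq)
    then obtain c where "u = c *s socle" unfolding Ann_eq by auto
    then show "u = 0" using step.prems(2)[of 1] socle(1) by (simp add: comp_of_homogeneous)
  qed
  from this[of 0 u] assms show ?thesis by simp
qed

text \<open>Nondegeneracy makes the map from \<open>u\<close> to its functional injective; it is
  surjective because the algebra and its dual have the same finite dimension.\<close>

lemma functional_represented:
  assumes "Vector_Spaces.linear scale (*) f"
  obtains u where "\<And>x. comp top_degree (u * x) = f x *s socle"
proof -
  obtain t where t: "Vector_Spaces.linear scale (*) t" "\<And>a. comp top_degree a = t a *s socle"
    using top_functional by blast
  interpret t: Vector_Spaces.linear scale "(*)" t by (rule t(1))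
  interpret f: Vector_Spaces.linear scale "(*)" f by (rule assms)
  obtain B where B: "finite B" "independent B" "span B = UNIV" using finite_span_UNIV by blast
  have coeff: "p b = q b" if "(\<Sum>b\<in>B. p b *s b) = (\<Sum>b\<in>B. q b *s b)" "b \<in> B" for p q b
  proof -
    have "(\<Sum>b\<in>B. (p b - q b) *s b) = 0"
      using that(1) by (simp add: scale_left_diff_distrib sum_subtractf)
    then have "p b - q b = 0"
      using independentD[OF B(2,1) subset_refl, of "\<lambda>b. p b - q b"] that(2) by blast
    then show ?thesis by simp
  qed
  text \<open>The basis identifies the dual space with the algebra, so that an endomorphism can be
    used in place of the map from the algebra to its dual.\<close>
  define S where "S u = (\<Sum>b\<in>B. t (u * b) *s b)" for u
  have linS: "Vector_Spaces.linear scale scale S"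
    unfolding S_def
    by unfold_locales
      (simp_all add: distrib_right t.add scale_left_distrib sum.distrib scale_mult_left t.scale scale_sum_right)
  interpret S: Vector_Spaces.linear scale scale S by (rule linS)
  have tlin: "Vector_Spaces.linear scale (*) (\<lambda>x. t (u * x))" for u
    by unfold_locales (simp_all add: algebra_simps t.add t.scale scale_mult_right)
  have "u = 0" if "S u = 0" for u
  proof -
    interpret tu: Vector_Spaces.linear scale "(*)" "\<lambda>x. t (u * x)" by (rule tlin)
    have "t (u * b) = 0" if "b \<in> B" for b
      using coeff[of "\<lambda>b. t (u * b)" "\<lambda>_. 0" b] \<open>S u = 0\<close> that by (simp add: S_def)
    then have "t (u * y) = 0" for y using tu.eq_0_on_span[of B y] B(3) by auto
    then have "comp top_degree (u * y) = 0" for y by (simp add: t(2))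
    then show ?thesis by (rule top_form_nondegenerate)
  qed
  then have "inj S" by (simp add: S.inj_iff_eq_0)
  then have "surj S" by (rule linear_inj_imp_surj[OF linS])
  then obtain u where u: "(\<Sum>b\<in>B. f b *s b) = S u" by (metis surjD)
  interpret d: Vector_Spaces.linear scale "(*)" "\<lambda>x. t (u * x) - f x"
    by unfold_locales (simp_all add: algebra_simps t.add t.scale scale_mult_right f.add f.scale)
  have "t (u * b) - f b = 0" if "b \<in> B" for b
    using coeff[of f "\<lambda>b. t (u * b)" b] u that by (simp add: S_def)
  then have "t (u * x) - f x = 0" for x using d.eq_0_on_span[of B x] B(3) by auto
  then show ?thesis using that t(2) by (metis eq_iff_diff_eq_0)
qed

section \<open>Solving for \<open>g\<close> degree by degree\<close>

text \<open>Only the linear term of the binomial expansion in \<open>v\<close> reaches degree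
  \<open>k\<close>: higher powers of \<open>v\<close> contribute from degree \<open>2 * k\<close>
  on.\<close>

lemma comp_power_perturb:
  assumes "v \<in> \<A> k" "k > 0" "comp 0 g = 1"
  shows "i < k \<Longrightarrow> comp i (w * (g + v) ^ n) = comp i (w * g ^ n)"
    and "comp k (w * (g + v) ^ n) = comp k (w * g ^ n) + of_nat n * (comp 0 w * v)"
proof -
  have v0: "comp 0 v = 0" using assms by (simp add: comp_of_homogeneous)
  \<comment> \<open>Both inductions move one factor \<open>g + v\<close> into \<open>w\<close>,
    which is why \<open>w\<close> is generalized there.\<close>
  have expand: "w * (g + v) ^ Suc n = (w * g + w * v) * (g + v) ^ n"
    "(w * g + w * v) * g ^ n = w * g ^ Suc n + w * g ^ n * v" for w n
    by (simp_all add: algebra_simps)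
  show "i < k \<Longrightarrow> comp i (w * (g + v) ^ n) = comp i (w * g ^ n)"
  proof (induction n arbitrary: w)
    case (Suc n)
    show ?case unfolding expand(1) Suc.IH[OF Suc.prems] unfolding expand(2)
      using Suc.prems by (simp add: comp_mult_homogeneous[OF assms(1)])
  qed simp
  show "comp k (w * (g + v) ^ n) = comp k (w * g ^ n) + of_nat n * (comp 0 w * v)"
  proof (induction n arbitrary: w)
    case (Suc n)
    show ?case unfolding expand(1) Suc.IH unfolding expand(2) comp_add comp_mult_homogeneous[OF assms(1)]
      using assms(2) by (simp add: assms(3) v0 algebra_simps)
  qed simp
qed

text \<open>The bound on \<open>k\<close> is strict because in degree \<open>top_degree\<close> the
  exponent is \<open>0\<close> and the equation does not involve \<open>g\<close>.\<close>

lemma power_equation_solvable: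
  assumes "comp 0 u = 1" "comp 0 w = 1" "k < top_degree"
  shows "\<exists>g. comp 0 g = 1 \<and> (\<forall>i\<le>k. comp i (w * g ^ (top_degree - i)) = comp i u)"
  using assms(3)
proof (induction k)
  case 0
  then show ?case using assms by (intro exI[of _ 1]) simp
next
  case (Suc k)
  then obtain g where g: "comp 0 g = 1" "\<And>i. i \<le> k \<Longrightarrow> comp i (w * g ^ (top_degree - i)) = comp i u"
    by auto
  define n where "n = top_degree - Suc k"
  \<comment> \<open>Adding \<open>v\<close> to \<open>g\<close> changes the component of degree
    \<open>Suc k\<close> by \<open>of_nat n * v\<close>, as \<open>comp 0 w = 1\<close>; this
    \<open>v\<close> cancels the error there and leaves the lower equations intact.\<close>
  define v where "v = (1 / of_nat n) *s (comp (Suc k) u - comp (Suc k) (w * g ^ n))"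
  have "n > 0" using Suc.prems by (simp add: n_def)
  have v: "v \<in> \<A> (Suc k)"
    unfolding v_def by (intro subspace_scale subspace_diff subspace_homogeneous comp_homogeneous)
  have nv: "of_nat n * v = comp (Suc k) u - comp (Suc k) (w * g ^ n)"
    using \<open>n > 0\<close> by (simp add: v_def of_nat_mult_eq_scale)
  show ?case
  proof (intro exI[of _ "g + v"] conjI allI impI)
    show "comp 0 (g + v) = 1" using g(1) v by (simp add: comp_of_homogeneous)
    fix i assume "i \<le> Suc k"
    then consider "i < Suc k" | "i = Suc k" by linarith
    then show "comp i (w * (g + v) ^ (top_degree - i)) = comp i u"
    proof cases
      case 1
      then show ?thesis using comp_power_perturb(1)[OF v _ g(1)] g(2)[of i] by simp
    next
      case 2
      then show ?thesis using comp_power_perturb(2)[OF v _ g(1), of w n] nv assms(2)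
        by (simp add: n_def)
    qed
  qed
qed

section \<open>The automorphisms given by \<open>g\<close>\<close>

text \<open>For a nonzero scalar \<open>g\<close> this is the dilation belonging to the grading;
  other \<open>g\<close> give maps that need not preserve the grading.\<close>

definition twist :: "'a \<Rightarrow> 'a \<Rightarrow> 'a" where
  "twist g x = (\<Sum>j\<le>top_degree. g ^ j * comp j x)"

lemma linear_twist: "Vector_Spaces.linear scale scale (twist g)"
  unfolding twist_def
  by unfold_locales (simp_all add: distrib_left sum.distrib scale_mult_right scale_sum_right)

lemma twist_homogeneous:
  assumes "x \<in> \<A> j"
  shows "twist g x = g ^ j * x"
proof (cases "j \<le> top_degree")
  case True
  have "twist g x = (\<Sum>i\<le>top_degree. if i = j then g ^ j * x else 0)"
    unfolding twist_def using assms by (intro sum.cong) (simp_all add: comp_of_homogeneous)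
  then show ?thesis using True by simp
next
  case False
  then show ?thesis using homogeneous_above_top[OF assms] by (simp add: twist_def)
qed

text \<open>On homogeneous factors \<open>g ^ (i + j)\<close> splits between them. Products beyond
  the top degree are zero, so the truncated sum in \<open>twist\<close> loses nothing.\<close>

lemma twist_mult: "twist g (x * y) = twist g x * twist g y"
proof -
  interpret t: Vector_Spaces.linear scale scale "twist g" by (rule linear_twist)
  have h: "twist g (comp i x * comp j y) = (g ^ i * comp i x) * (g ^ j * comp j y)" for i j
    using twist_homogeneous[OF mult_homogeneous[OF comp_homogeneous comp_homogeneous]]
    by (simp add: power_add mult_ac)
  have "twist g ((\<Sum>i\<le>top_degree. comp i x) * (\<Sum>j\<le>top_degree. comp j y)) = twist g x * twist g y"
    unfolding sum_product t.sum h unfolding twist_def sum_product ..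
  then show ?thesis by (simp only: sum_comp_top)
qed

text \<open>Since \<open>g ^ i\<close> has degree-zero component \<open>1\<close> and otherwise
  raises degrees, \<open>twist g\<close> is unitriangular. This gives injectivity and, with
  \<open>j = 0\<close>, the invariance of \<open>\<mm>\<close>.\<close>

lemma comp_twist:
  assumes "comp 0 g = 1" "\<And>i. i < j \<Longrightarrow> comp i x = 0"
  shows "comp j (twist g x) = comp j x"
proof (cases "j \<le> top_degree")
  case True
  have "comp j (g ^ i * comp i x) = (if i = j then comp j x else 0)" for i
    using assms by (cases "i < j") (simp_all add: comp_mult_homogeneous[OF comp_homogeneous])
  then show ?thesis using True by (simp add: twist_def)
qed (simp add: comp_above_top)

lemma bij_twist:
  assumes "comp 0 g = 1"
  shows "bij (twist g)"
proof -
  interpret t: Vector_Spaces.linear scale scale "twist g" by (rule linear_twist)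
  have "x = 0" if "twist g x = 0" for x
  proof (rule comp_eq_0_imp)
    show "comp j x = 0" for j
    proof (induction j rule: less_induct)
      case (less j)
      then show ?case using comp_twist[OF assms, of j x] that by simp
    qed
  qed
  then have "inj (twist g)" by (simp add: t.inj_iff_eq_0)
  then show ?thesis
    using linear_inj_imp_surj[OF linear_twist] by (blast intro: bijI)
qed

lemma twist_in_max_ideal_iff: "comp 0 g = 1 \<Longrightarrow> twist g x \<in> \<mm> \<longleftrightarrow> x \<in> \<mm>"
  using comp_twist[of g 0 x] by (simp add: max_ideal_eq)

lemma twist_Aut:
  assumes "comp 0 g = 1"
  shows "twist g \<in> Aut_max_ideal"
proof -
  interpret t: Vector_Spaces.linear scale scale "twist g" by (rule linear_twist)
  have "bij_betw (twist g) \<mm> \<mm>"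
    using bij_twist[OF assms] twist_in_max_ideal_iff[OF assms]
    by (auto simp: bij_betw_def bij_def inj_on_def image_iff) (metis surjD)
  then show ?thesis unfolding Aut_max_ideal_def by (simp add: t.add t.scale twist_mult)
qed

section \<open>Transitivity on the complementary hyperplanes\<close>

lemma graded_property_P: "property_P"
  unfolding property_P_def
proof (intro ballI)
  fix \<Pi>\<^sub>1 \<Pi>\<^sub>2 assume \<Pi>: "\<Pi>\<^sub>1 \<in> \<T>" "\<Pi>\<^sub>2 \<in> \<T>"
  obtain f where f: "Vector_Spaces.linear scale (*) f" "f socle = 1" "\<Pi>\<^sub>1 = {x \<in> \<mm>. f x = 0}"
    using hyperplane_functional[OF \<Pi>(1)] .
  obtain h where h: "Vector_Spaces.linear scale (*) h" "h socle = 1" "\<Pi>\<^sub>2 = {x \<in> \<mm>. h x = 0}"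
    using hyperplane_functional[OF \<Pi>(2)] .
  obtain u where u: "\<And>x. comp top_degree (u * x) = f x *s socle"
    using functional_represented[OF f(1)] by blast
  obtain w where w: "\<And>x. comp top_degree (w * x) = h x *s socle"
    using functional_represented[OF h(1)] by blast
  \<comment> \<open>Multiplying by \<open>socle\<close> detects only the degree-zero component, so
    the value \<open>1\<close> of the functional at \<open>socle\<close> fixes that
    component.\<close>
  have unit: "comp 0 a = 1" if "comp top_degree (a * socle) = socle" for a
  proof -
    obtain r where r: "comp 0 a = r *s 1" by (rule comp_zero_scalar)
    have "comp 0 a * socle = socle"
      using that by (simp add: comp_mult_homogeneous[OF socle(1)])
    then have "r *s socle = 1 *s socle" using r by (simp add: scale_mult_left)
    then have "r = 1" by (rule scale_right_imp_eq[OF socle(2)])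
    then show ?thesis using r by simp
  qed
  have "comp 0 u = 1" "comp 0 w = 1" using u w f(2) h(2) by (auto intro: unit)
  then obtain g where g: "comp 0 g = 1"
    "\<And>i. i \<le> top_degree - 1 \<Longrightarrow> comp i (w * g ^ (top_degree - i)) = comp i u"
    using power_equation_solvable[of u w "top_degree - 1"] top_degree_pos by auto
  have hf: "h (twist g x) = f x" if "x \<in> \<mm>" for x
  proof -
    \<comment> \<open>For \<open>i = top_degree - j\<close> the exponent in the equation for
      \<open>g\<close> is \<open>j\<close>, the weight used by \<open>twist\<close>. The degree
      \<open>i = top_degree\<close> left out belongs to \<open>j = 0\<close>, where elements of
      \<open>\<mm>\<close> have no component.\<close>
    have *: "comp top_degree (w * (g ^ j * comp j x)) = comp top_degree (u * comp j x)"
      if "j \<le> top_degree" for j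
    proof (cases "j = 0")
      case False
      then have "comp (top_degree - j) (w * g ^ j) = comp (top_degree - j) u"
        using g(2)[of "top_degree - j"] \<open>j \<le> top_degree\<close> by simp
      then show ?thesis using \<open>j \<le> top_degree\<close>
        by (simp add: comp_mult_homogeneous[OF comp_homogeneous] mult.assoc[symmetric])
    qed (use \<open>x \<in> \<mm>\<close> in \<open>simp add: max_ideal_eq\<close>)
    have "h (twist g x) *s socle = comp top_degree (w * twist g x)" by (simp only: w)
    also have "\<dots> = (\<Sum>j\<le>top_degree. comp top_degree (u * comp j x))"
      unfolding twist_def sum_distrib_left comp_sum by (intro sum.cong) (simp_all add: * del: comp_comp)
    also have "\<dots> = comp top_degree (u * (\<Sum>j\<le>top_degree. comp j x))"
      by (simp only: sum_distrib_left comp_sum)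
    also have "\<dots> = f x *s socle" by (simp only: sum_comp_top u)
    finally show ?thesis by (rule scale_right_imp_eq[OF socle(2)])
  qed
  have "twist g ` \<Pi>\<^sub>1 = \<Pi>\<^sub>2"
  proof (intro equalityI subsetI)
    fix y assume "y \<in> \<Pi>\<^sub>2"
    moreover obtain x where "y = twist g x" using bij_twist[OF g(1)] by (metis bij_pointE)
    ultimately show "y \<in> twist g ` \<Pi>\<^sub>1" using f(3) h(3) hf twist_in_max_ideal_iff[OF g(1)] by auto
  qed (use f(3) h(3) hf twist_in_max_ideal_iff[OF g(1)] in auto)
  then show "\<exists>\<phi>\<in>Aut_max_ideal. \<phi> ` \<Pi>\<^sub>1 = \<Pi>\<^sub>2" using twist_Aut[OF g(1)] by blast
qed

end

theorem theorem2p4: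
  fixes scale :: "'f::field_char_0 \<Rightarrow> 'a::comm_ring_1 \<Rightarrow> 'a"
  assumes "gorenstein_algebra scale"
    and "comm_algebra.graded scale"
  shows "comm_algebra.property_P scale"
proof -
  interpret gorenstein_algebra scale by (rule assms(1))
  obtain \<A> where "is_grading \<A>" using assms(2) unfolding graded_def by blast
  then interpret graded_gorenstein_algebra scale \<A> by unfold_locales
  show ?thesis by (rule graded_property_P)
qed

end
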